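(* Let $H$ be a connected graph with at least three nodes and let $r'_H = \operatorname{diam}(H) - 1$. For every integer $T < r'_H$, there exists no $T$-round algorithm for $\textsc{MemList}(H)$ or for $\textsc{MemDetect}(H)$ under node insertions, and none under node deletions.
   Context: $\operatorname{diam}(H)$ is the (ordinary) diameter of $H$. Dynamic network model: a sequence of graphs $G^0, G^1, \ldots$, each obtained from the previous by at most one topological change of the allowed type (a node insertion adds a new node adjacent to an arbitrary subset of existing nodes; a node deletion removes a node and its incident edges); nodes have distinct IDs, know their neighbors' IDs and initially the whole of $G^0$; communication is synchronous, each round the change happens first and then each node sends a message to each neighbor (bandwidth arbitrary); nodes detect changes only through their neighbor lists. A $T$-round algorithm works under the promise that each change at round $i$ is followed by $T-1$ change-free rounds and must output correctly for $G^i$ by the end of round $i+T-1$. $\textsc{MemList}(H)$: each node $v$ lists all subgraphs isomorphic to $H$ containing $v$. $\textsc{MemDetect}(H)$: each node $v$ outputs whether it belongs to some subgraph isomorphic to $H$. *)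

theory Defs
  imports "Graph_Theory.Graph_Theory"
begin

text \<open>
  Finite simple undirected graphs are the symmetric loop-free digraphs \<^locale>\<open>pair_graph\<close> of the
  library: an edge between \<open>u\<close> and \<open>v\<close> is the pair of arcs \<open>(u, v)\<close>, \<open>(v, u)\<close>.
\<close>

section \<open>Diameter, neighbours and copies of a pattern\<close>

text \<open>The weight function constantly 1 turns the library's weighted distance into the hop distance.\<close>

definition diam :: "'a pair_pre_digraph \<Rightarrow> ereal" where
  "diam H = (SUP u \<in> pverts H. SUP v \<in> pverts H. wf_digraph.\<mu> (with_proj H) (\<lambda>_. 1) u v)"

definition nbrs :: "'v pair_pre_digraph \<Rightarrow> 'v \<Rightarrow> 'v set" where
  "nbrs G v = {u. (v, u) \<in> parcs G}"

text \<open>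
  Not necessarily induced subgraphs. An \<open>S\<close> isomorphic to a symmetric loop-free \<open>H\<close> is itself
  symmetric and loop-free.
\<close>

definition copies_at :: "'a pair_pre_digraph \<Rightarrow> 'v pair_pre_digraph \<Rightarrow> 'v \<Rightarrow> 'v pair_pre_digraph set" where
  "copies_at H G v =
     {S. subgraph (with_proj S) (with_proj G) \<and> digraph_iso (with_proj H) (with_proj S) \<and> v \<in> pverts S}"


section \<open>Dynamic networks\<close>

text \<open>Nodes are identified with their IDs, which are natural numbers.\<close>

type_synonym network = "nat pair_pre_digraph"

definition node_insertion :: "network \<Rightarrow> network \<Rightarrow> bool" where
  "node_insertion G G' \<longleftrightarrow>
     (\<exists>v N. v \<notin> pverts G \<and> N \<subseteq> pverts G \<and>
        G' = \<lparr> pverts = insert v (pverts G), parcs = parcs G \<union> {v} \<times> N \<union> N \<times> {v} \<rparr>)"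

definition node_deletion :: "network \<Rightarrow> network \<Rightarrow> bool" where
  "node_deletion G G' \<longleftrightarrow>
     (\<exists>v \<in> pverts G.
        G' = \<lparr> pverts = pverts G - {v}, parcs = {(x, y) \<in> parcs G. x \<noteq> v \<and> y \<noteq> v} \<rparr>)"

text \<open>
  \<open>G i\<close> is the graph of round \<open>i\<close>. Rounds are numbered from 1; \<open>G 0\<close> is the initial graph.
\<close>

definition changes_at :: "(nat \<Rightarrow> network) \<Rightarrow> nat \<Rightarrow> bool" where
  "changes_at G i \<longleftrightarrow> 1 \<le> i \<and> G i \<noteq> G (i - 1)"

definition dynamic_network :: "(network \<Rightarrow> network \<Rightarrow> bool) \<Rightarrow> (nat \<Rightarrow> network) \<Rightarrow> bool" where
  "dynamic_network change G \<longleftrightarrow>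
     pair_graph (G 0) \<and> (\<forall>i. changes_at G i \<longrightarrow> change (G (i - 1)) (G i))"

definition spaced_changes :: "int \<Rightarrow> (nat \<Rightarrow> network) \<Rightarrow> bool" where
  "spaced_changes T G \<longleftrightarrow>
     (\<forall>i j. changes_at G i \<and> i < j \<and> int j \<le> int i + T - 1 \<longrightarrow> \<not> changes_at G j)"


section \<open>Distributed algorithms\<close>

text \<open>
  States \<open>'s\<close>, messages \<open>'m\<close> and outputs \<open>'o\<close> are arbitrary types, so bandwidth and local computation
  are unrestricted.

  \<^item> \<open>init v G\<^sub>0\<close> is the state in which node \<open>v\<close> starts, from its own ID and the initial graph; this
    also applies to nodes inserted later. Granting them the knowledge of the initial graph makes
    algorithms more powerful, hence the impossibility stronger.
  \<^item> \<open>send s N u\<close> is the message to neighbour \<open>u\<close> of a node in state \<open>s\<close> with current neighbour list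
    \<open>N\<close>.
  \<^item> \<open>update s N R\<close> is the next state, where \<open>R u\<close> is the message received from \<open>u\<close>, if \<open>u\<close> is a
    neighbour.
\<close>

record ('s, 'm, 'o) algorithm =
  init :: "nat \<Rightarrow> network \<Rightarrow> 's"
  send :: "'s \<Rightarrow> nat set \<Rightarrow> nat \<Rightarrow> 'm"
  update :: "'s \<Rightarrow> nat set \<Rightarrow> (nat \<Rightarrow> 'm option) \<Rightarrow> 's"
  result :: "'s \<Rightarrow> 'o"

text \<open>
  \<open>state_after A G i v\<close> is the state of \<open>v\<close> at the end of round \<open>i\<close>; it is meaningful for nodes of
  \<open>G i\<close> only. In round \<open>i + 1\<close> the graph first becomes \<open>G (i + 1)\<close>, an inserted node starts in its
  initial state, and then the messages travel along the edges of \<open>G (i + 1)\<close>.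
\<close>

primrec state_after ::
    "('s, 'm, 'o) algorithm \<Rightarrow> (nat \<Rightarrow> network) \<Rightarrow> nat \<Rightarrow> nat \<Rightarrow> 's" where
  "state_after A G 0 = (\<lambda>v. init A v (G 0))"
| "state_after A G (Suc i) =
     (let s = (\<lambda>v. if v \<in> pverts (G i) then state_after A G i v else init A v (G 0));
          N = nbrs (G (Suc i))
      in (\<lambda>v. update A (s v) (N v)
                (\<lambda>u. if u \<in> N v then Some (send A (s u) (N u) v) else None)))"

text \<open>
  A problem assigns to each graph and node the required output. The change of round \<open>i\<close> has to be
  reflected in the outputs at the end of round \<open>r = i + T - 1\<close>. For \<open>T \<ge> 1\<close> the graphs \<open>G r\<close> and
  \<open>G i\<close> coincide under the promise; for \<open>T \<le> 0\<close>, that is \<open>r < i\<close>, only nodes present in both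
  graphs have an output to be checked.
\<close>

definition round_algorithm ::
    "int \<Rightarrow> (network \<Rightarrow> network \<Rightarrow> bool) \<Rightarrow> (network \<Rightarrow> nat \<Rightarrow> 'o) \<Rightarrow> ('s, 'm, 'o) algorithm \<Rightarrow> bool"
where
  "round_algorithm T change problem A \<longleftrightarrow>
     (\<forall>G. dynamic_network change G \<and> spaced_changes T G \<longrightarrow>
        (\<forall>i r. changes_at G i \<and> int r = int i + T - 1 \<longrightarrow>
           (\<forall>v \<in> pverts (G i) \<inter> pverts (G r).
              result A (state_after A G r v) = problem (G i) v)))"

definition mem_list :: "'a pair_pre_digraph \<Rightarrow> network \<Rightarrow> nat \<Rightarrow> network set" where
  "mem_list H G v = copies_at H G v"

definition mem_detect :: "'a pair_pre_digraph \<Rightarrow> network \<Rightarrow> nat \<Rightarrow> bool" where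
  "mem_detect H G v \<longleftrightarrow> copies_at H G v \<noteq> {}"

end

theory Submission
  imports Defs
begin

text \<open>
  Take nodes \<open>x\<close>, \<open>v\<close> of \<open>H\<close> at distance at least \<open>T + 2\<close> and a fresh isolated node \<open>w\<close>. Under
  deletions, start from \<open>H + w\<close> and delete either \<open>w\<close>, which leaves a copy of \<open>H\<close>, or \<open>x\<close>, which
  leaves none: only \<open>|H|\<close> nodes remain and one of them is isolated. Under insertions, start from
  \<open>H - x\<close> and insert either \<open>x\<close> or \<open>w\<close>, with the same two results. In the round of the change already
  the neighbours of \<open>x\<close> send different messages, so after \<open>T\<close> rounds the nodes within distance
  \<open>T + 1\<close> of \<open>x\<close> may tell the two executions apart, but \<open>v\<close> cannot. The isolated \<open>w\<close> is needed because
  an output is only required after a change.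
\<close>

section \<open>Deletion and insertion of a single node\<close>

definition delete_node :: "'v \<Rightarrow> 'v pair_pre_digraph \<Rightarrow> 'v pair_pre_digraph" where
  "delete_node v G = \<lparr> pverts = pverts G - {v}, parcs = {(x, y) \<in> parcs G. x \<noteq> v \<and> y \<noteq> v} \<rparr>"

definition insert_node :: "'v \<Rightarrow> 'v set \<Rightarrow> 'v pair_pre_digraph \<Rightarrow> 'v pair_pre_digraph" where
  "insert_node v N G = \<lparr> pverts = insert v (pverts G), parcs = parcs G \<union> {v} \<times> N \<union> N \<times> {v} \<rparr>"

lemma pverts_delete_node [simp]: "pverts (delete_node v G) = pverts G - {v}"
  and parcs_delete_node [simp]: "parcs (delete_node v G) = {(x, y) \<in> parcs G. x \<noteq> v \<and> y \<noteq> v}"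
  and pverts_insert_node [simp]: "pverts (insert_node v N G) = insert v (pverts G)"
  and parcs_insert_node [simp]: "parcs (insert_node v N G) = parcs G \<union> {v} \<times> N \<union> N \<times> {v}"
  by (simp_all add: delete_node_def insert_node_def)

lemma node_deletion_delete_node: "v \<in> pverts G \<Longrightarrow> node_deletion G (delete_node v G)"
  by (auto simp: node_deletion_def delete_node_def)

lemma node_insertion_insert_node:
  "v \<notin> pverts G \<Longrightarrow> N \<subseteq> pverts G \<Longrightarrow> node_insertion G (insert_node v N G)"
  by (auto simp: node_insertion_def insert_node_def)

lemma pair_graph_iff:
  "pair_graph G \<longleftrightarrow> finite (pverts G) \<and> parcs G \<subseteq> pverts G \<times> pverts G \<and> sym (parcs G) \<and>
     (\<forall>v. (v, v) \<notin> parcs G)"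
  (is "?L \<longleftrightarrow> ?R")
proof
  assume ?L
  then interpret pair_graph G .
  show ?R
    using pair_finite_verts pair_sym_arcs
    by (auto simp: symmetric_def dest: in_arcsD1 in_arcsD2 no_loops')
next
  assume R: ?R
  then have "finite (parcs G)"
    by (meson finite_SigmaI finite_subset)
  with R show ?L
    by unfold_locales (auto simp: symmetric_def)
qed

lemma pair_graph_delete_node: "pair_graph G \<Longrightarrow> pair_graph (delete_node v G)"
  by (auto simp: pair_graph_iff sym_def)

lemma pair_graph_insert_node:
  "pair_graph G \<Longrightarrow> v \<notin> pverts G \<Longrightarrow> N \<subseteq> pverts G \<Longrightarrow> pair_graph (insert_node v N G)"
  by (auto simp: pair_graph_iff sym_def)

text \<open>Presents \<open>G\<close> as the outcome of an insertion: by symmetry the arcs at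
  \<open>v\<close> are exactly those in the two products with \<open>nbrs G v\<close>.\<close>

lemma insert_delete_node:
  assumes "pair_graph G" "v \<in> pverts G"
  shows "insert_node v (nbrs G v) (delete_node v G) = G"
  using assms by (intro pair_pre_digraph.equality)
    (auto simp: pair_graph_iff nbrs_def sym_def)

lemma delete_insert_node:
  assumes "pair_graph G" "v \<notin> pverts G"
  shows "delete_node v (insert_node v N G) = G"
  using assms by (intro pair_pre_digraph.equality) (auto simp: pair_graph_iff)

lemma delete_insert_isolated:
  "v \<noteq> w \<Longrightarrow> delete_node v (insert_node w {} G) = insert_node w {} (delete_node v G)"
  by (intro pair_pre_digraph.equality) auto


section \<open>Copies of a pattern\<close>

text \<open>Carries the pattern, whose vertices have an arbitrary type, over to networks, whose
  nodes are numbers.\<close>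

definition map_graph :: "('a \<Rightarrow> 'b) \<Rightarrow> 'a pair_pre_digraph \<Rightarrow> 'b pair_pre_digraph" where
  "map_graph f G = \<lparr> pverts = f ` pverts G, parcs = map_prod f f ` parcs G \<rparr>"

lemma pverts_map_graph [simp]: "pverts (map_graph f G) = f ` pverts G"
  and parcs_map_graph [simp]: "parcs (map_graph f G) = map_prod f f ` parcs G"
  by (simp_all add: map_graph_def)

lemma pair_graph_map_graph:
  assumes "pair_graph G" "inj_on f (pverts G)"
  shows "pair_graph (map_graph f G)"
  using assms by (fastforce simp: pair_graph_iff sym_def dest: inj_onD)

lemma digraph_iso_map_graph:
  assumes "pair_graph G" "inj_on f (pverts G)"
  shows "digraph_iso (with_proj G) (with_proj (map_graph f G))"
proof -
  \<comment> \<open>The image is again a \<open>with_proj\<close> graph, so its tail and head must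
    be the pair projections.\<close>
  let ?h = "\<lparr> iso_verts = f, iso_arcs = map_prod f f, iso_head = snd, iso_tail = fst \<rparr>"
  interpret pair_graph G by fact
  have "inj_on (map_prod f f) (parcs G)"
    using assms by (intro inj_on_subset[OF map_prod_inj_on]) (auto simp: pair_graph_iff)
  then have "pre_digraph.digraph_isomorphism (with_proj G) ?h"
    using assms(2) wf_digraph_axioms by (simp add: pre_digraph.digraph_isomorphism_def)
  moreover have "with_proj (map_graph f G) = app_iso ?h (with_proj G)"
    by (simp add: app_iso_def with_proj_def)
  ultimately show ?thesis
    unfolding digraph_iso_def by blast
qed

lemma map_graph_in_copies_at:
  assumes "pair_graph G" "inj_on f (pverts G)" "v \<in> f ` pverts G"
  shows "map_graph f G \<in> copies_at G (map_graph f G) v"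
proof -
  interpret K: pair_graph "map_graph f G"
    using assms by (simp add: pair_graph_map_graph)
  show ?thesis
    using digraph_iso_map_graph[OF assms(1,2)] assms(3) K.wf_digraph_axioms
    by (simp add: copies_at_def subgraph_def compatible_def)
qed

text \<open>A walk from \<open>u\<close> to some other vertex begins with an arc at
  \<open>u\<close>.\<close>

lemma connected_imp_out_arc:
  assumes "pair_graph H" "Digraph_Component.connected (with_proj H)" "card (pverts H) \<ge> 2"
    and "u \<in> pverts H"
  obtains y where "(u, y) \<in> parcs H"
proof -
  interpret pair_graph H by fact
  obtain z where z: "z \<in> pverts H" "z \<noteq> u"
    using assms(3) by (metis card_2_iff' card_le_Suc0_iff_eq not_less_eq_eq numeral_2_eq_2
        pair_finite_verts assms(4))
  have "strongly_connected (with_proj H)"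
    using symmetric_connected_imp_strongly_connected pair_sym_arcs assms(2) by blast
  then have "u \<rightarrow>\<^sup>*\<^bsub>with_proj H\<^esub> z"
    using z(1) assms(4) by auto
  then obtain p where "awalk u p z"
    by (auto simp: reachable_awalk)
  with z(2) that show ?thesis
    by (cases p) (auto simp: awalk_simps)
qed

text \<open>By counting, a copy would cover all of \<open>G\<close>, so some vertex \<open>u\<close>
  of \<open>H\<close> would be sent to \<open>w\<close>. But \<open>u\<close> has an outgoing arc,
  whose image would leave \<open>w\<close>.\<close>

lemma copies_at_isolated_empty:
  assumes H: "pair_graph H" "Digraph_Component.connected (with_proj H)" "card (pverts H) \<ge> 2"
    and G: "finite (pverts G)" "card (pverts G) \<le> card (pverts H)" "w \<in> pverts G" "nbrs G w = {}"
  shows "copies_at H G v = {}"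
proof (rule equals0I)
  fix S assume "S \<in> copies_at H G v"
  then obtain h where sub: "subgraph (with_proj S) (with_proj G)"
    and h: "pre_digraph.digraph_isomorphism (with_proj H) h"
    and S: "with_proj S = app_iso h (with_proj H)"
    by (auto simp: copies_at_def digraph_iso_def)
  \<comment> \<open>The isomorphism \<open>h\<close> chooses the tail function of its image; the
    image being \<open>with_proj S\<close> forces it to be \<open>fst\<close>.\<close>
  have pS: "pverts S = iso_verts h ` pverts H" "parcs S = iso_arcs h ` parcs H"
    "fst = iso_tail h"
    using S by (simp_all add: with_proj_def app_iso_def)
  have "card (pverts S) = card (pverts H)"
    using h by (simp add: pS card_image pre_digraph.digraph_isomorphism_def)
  moreover have "pverts S \<subseteq> pverts G"
    using sub by (simp add: subgraph_def)
  ultimately have "pverts S = pverts G"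
    using G(1,2) by (metis card_seteq)
  then obtain u where u: "u \<in> pverts H" "iso_verts h u = w"
    using G(3) pS(1) by (metis imageE)
  obtain y where y: "(u, y) \<in> parcs H"
    using connected_imp_out_arc[OF H u(1)] .
  then have "fst (iso_arcs h (u, y)) = w"
    using h u(2) pS(3) by (auto simp: pre_digraph.digraph_isomorphism_def)
  moreover have "iso_arcs h (u, y) \<in> parcs G"
    using y sub pS(2) by (auto simp: subgraph_def)
  ultimately have "snd (iso_arcs h (u, y)) \<in> nbrs G w"
    by (simp add: nbrs_def) (metis prod.collapse)
  with G(4) show False by simp
qed


section \<open>Distant nodes and the spread of information\<close>

text \<open>\<open>B n\<close> is the ball of radius \<open>n\<close> around \<open>x\<close>. For \<open>T \<le> -2\<close> the last property is void.\<close>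

lemma obtain_distant_nodes:
  fixes T :: int
  assumes "pair_graph H" "card (pverts H) \<ge> 2" "ereal (real_of_int T) < diam H - 1"
  obtains x v B where "x \<in> pverts H" "v \<in> pverts H" "x \<noteq> v" "x \<in> B 0"
    "\<And>n :: nat. B n \<subseteq> pverts H" "\<And>n. B n \<subseteq> B (Suc n)"
    "\<And>n y z. y \<in> B n \<Longrightarrow> (y, z) \<in> parcs H \<Longrightarrow> z \<in> B (Suc n)"
    "\<And>n. int n \<le> T + 1 \<Longrightarrow> v \<notin> B n"
proof -
  interpret pair_graph H by fact
  define B where "B x n = {y. \<exists>p. awalk x p y \<and> length p \<le> n}" for x n
  have ball: "x \<in> B x 0" if "x \<in> pverts H" for x
    using that by (auto simp: B_def awalk_simps)
  have ball_step: "z \<in> B x (Suc n)" if y: "y \<in> B x n" "(y, z) \<in> parcs H" for x n y z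
  proof -
    obtain p where "awalk x p y" "length p \<le> n"
      using y(1) by (auto simp: B_def)
    then have "awalk x (p @ [(y, z)]) z"
      using y(2) by (auto simp: awalk_simps in_arcsD1 in_arcsD2 intro!: awalk_appendI)
    then show ?thesis
      using \<open>length p \<le> n\<close> by (auto simp: B_def intro!: exI[of _ "p @ [(y, z)]"])
  qed
  have "\<exists>x \<in> pverts H. \<exists>v \<in> pverts H. x \<noteq> v \<and> (\<forall>n. int n \<le> T + 1 \<longrightarrow> v \<notin> B x n)"
  proof (cases "T + 1 \<ge> 0")
    case True
    have "ereal (real_of_int T + 1) < diam H"
      using assms(3) by (cases "diam H") (auto simp: one_ereal_def)
    then obtain x v where xv: "x \<in> pverts H" "v \<in> pverts H"
      "ereal (real_of_int T + 1) < \<mu> (\<lambda>_. 1) x v"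
      by (auto simp: diam_def less_SUP_iff)
    have far: "v \<notin> B x n" if "int n \<le> T + 1" for n
    proof
      assume "v \<in> B x n"
      then obtain p where p: "awalk x p v" "length p \<le> n"
        by (auto simp: B_def)
      \<comment> \<open>With unit weights the cost of a walk is its length, so \<open>p\<close>
        bounds the distance by \<open>n\<close>.\<close>
      have "awalk_cost (\<lambda>_. 1) p = real (length p)"
        by (simp add: awalk_cost_def sum_list_triv)
      then have "\<mu> (\<lambda>_. 1) x v \<le> ereal (real (length p))"
        using min_cost_le_walk_cost[OF p(1), of "\<lambda>_. 1"] by simp
      then have "ereal (real_of_int T + 1) < ereal (real (length p))"
        using xv(3) by (rule less_le_trans[rotated])
      with p(2) that show False by simp
    qed
    \<comment> \<open>Since \<open>0 \<le> T + 1\<close>, \<open>v\<close> is outside the ball of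
      radius 0, which contains \<open>x\<close>.\<close>
    have "x \<noteq> v"
      using far[of 0] ball[OF xv(1)] True by auto
    with xv far show ?thesis by blast
  next
    case False
    obtain x v where "x \<in> pverts H" "v \<in> pverts H" "x \<noteq> v"
      using assms(2) pair_finite_verts
      by (metis card_le_Suc0_iff_eq not_less_eq_eq numeral_2_eq_2)
    with False show ?thesis
      by (intro bexI[of _ x] bexI[of _ v]) auto
  qed
  then obtain x v where "x \<in> pverts H" "v \<in> pverts H" "x \<noteq> v"
    "\<And>n. int n \<le> T + 1 \<Longrightarrow> v \<notin> B x n"
    by blast
  moreover have "B x n \<subseteq> pverts H" "B x n \<subseteq> B x (Suc n)" for n
    by (auto simp: B_def)
  ultimately show ?thesis
    using that[of x v "B x"] ball ball_step by blast
qed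

section \<open>Executions with a single change\<close>

definition single_change :: "nat \<Rightarrow> network \<Rightarrow> network \<Rightarrow> nat \<Rightarrow> network" where
  "single_change i G\<^sub>0 G\<^sub>1 j = (if j < i then G\<^sub>0 else G\<^sub>1)"

lemma single_change_before [simp]: "j < i \<Longrightarrow> single_change i G\<^sub>0 G\<^sub>1 j = G\<^sub>0"
  and single_change_after [simp]: "i \<le> j \<Longrightarrow> single_change i G\<^sub>0 G\<^sub>1 j = G\<^sub>1"
  by (simp_all add: single_change_def)

lemma changes_at_single_change:
  "G\<^sub>0 \<noteq> G\<^sub>1 \<Longrightarrow> 1 \<le> i \<Longrightarrow> changes_at (single_change i G\<^sub>0 G\<^sub>1) j \<longleftrightarrow> j = i"
  by (auto simp: changes_at_def single_change_def)

text \<open>With only one change the spacing promise holds for every \<open>T\<close>.\<close>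

lemma round_algorithm_single_change:
  assumes "round_algorithm T change problem A" "pair_graph G\<^sub>0" "change G\<^sub>0 G\<^sub>1" "G\<^sub>0 \<noteq> G\<^sub>1" "1 \<le> i"
    and "int r = int i + T - 1" "v \<in> pverts G\<^sub>0" "v \<in> pverts G\<^sub>1"
  shows "result A (state_after A (single_change i G\<^sub>0 G\<^sub>1) r v) = problem G\<^sub>1 v"
proof -
  let ?G = "single_change i G\<^sub>0 G\<^sub>1"
  have "dynamic_network change ?G"
    using assms by (auto simp: dynamic_network_def changes_at_single_change)
  moreover have "spaced_changes T ?G"
    using assms by (auto simp: spaced_changes_def changes_at_single_change)
  moreover have "v \<in> pverts (?G i) \<inter> pverts (?G r)" "?G i = G\<^sub>1" "changes_at ?G i"
    using assms by (auto simp: changes_at_single_change single_change_def)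
  ultimately show ?thesis
    using assms(1,6) unfolding round_algorithm_def by metis
qed

text \<open>Locality of one round: \<open>u\<close> hears only from its current neighbours. Earlier
  presence matters because a newcomer starts from \<open>init\<close>.\<close>

lemma state_after_Suc_cong:
  assumes "G 0 = G' 0" "nbrs (G (Suc j)) u = nbrs (G' (Suc j)) u"
    and "\<And>y. y = u \<or> y \<in> nbrs (G (Suc j)) u \<Longrightarrow>
           (y \<in> pverts (G j) \<longleftrightarrow> y \<in> pverts (G' j)) \<and> nbrs (G (Suc j)) y = nbrs (G' (Suc j)) y \<and>
           state_after A G j y = state_after A G' j y"
  shows "state_after A G (Suc j) u = state_after A G' (Suc j) u"
proof -
  let ?R = "\<lambda>G y. if y \<in> nbrs (G (Suc j)) u
    then Some (send A (if y \<in> pverts (G j) then state_after A G j y else init A y (G 0))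
      (nbrs (G (Suc j)) y) u) else None"
  have "?R G = ?R G'"
    using assms by auto
  then show ?thesis
    using assms by (simp add: Let_def)
qed

lemma state_after_cong:
  "(\<And>k. k \<le> j \<Longrightarrow> G k = G' k) \<Longrightarrow> state_after A G j u = state_after A G' j u"
proof (induction j arbitrary: u)
  case (Suc j)
  then show ?case
    by (intro state_after_Suc_cong) simp_all
qed simp

text \<open>\<open>B 1\<close> contains every node whose presence or neighbour list differs. Already
  in round \<open>i\<close> these may send different messages, which reach \<open>B 2\<close>; each
  further round adds one to the radius, hence \<open>k + 2\<close>.\<close>

lemma state_after_outside_ball:
  assumes "1 \<le> i"
    and mono: "\<And>n. B n \<subseteq> B (Suc n)"
    and same: "\<And>u. u \<notin> B 1 \<Longrightarrow> (u \<in> pverts G\<^sub>1 \<longleftrightarrow> u \<in> pverts G\<^sub>2) \<and> nbrs G\<^sub>1 u = nbrs G\<^sub>2 u"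
    and step: "\<And>n u y. y \<in> nbrs G\<^sub>1 u \<Longrightarrow> y \<in> B n \<Longrightarrow> u \<in> B (Suc n)"
    and "u \<notin> B (k + 2)"
  shows "state_after A (single_change i G\<^sub>0 G\<^sub>1) (i + k) u
       = state_after A (single_change i G\<^sub>0 G\<^sub>2) (i + k) u"
  using assms(5)
proof (induction k arbitrary: u)
  case 0
  obtain j where j: "i = Suc j"
    using assms(1) by (cases i) auto
  \<comment> \<open>A neighbour of \<open>u\<close> in \<open>B 1\<close> would put \<open>u\<close>
    into \<open>B 2\<close>.\<close>
  have "y \<notin> B 1" if "y = u \<or> y \<in> nbrs G\<^sub>1 u" for y
    using that 0 mono[of 1] step[of y u 1] by (auto simp: numeral_2_eq_2)
  \<comment> \<open>Both executions run on \<open>G\<^sub>0\<close> up to round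
    \<open>j\<close>.\<close>
  then show ?case
    using same state_after_cong[of j "single_change i G\<^sub>0 G\<^sub>1" "single_change i G\<^sub>0 G\<^sub>2"]
    unfolding j add_0_right
    by (intro state_after_Suc_cong) auto
next
  case (Suc k)
  have out: "y \<notin> B (k + 2)" if "y = u \<or> y \<in> nbrs G\<^sub>1 u" for y
    using that Suc.prems mono[of "k + 2"] step[of y u "k + 2"] by auto
  have "B 1 \<subseteq> B (k + 2)"
    using lift_Suc_mono_le[of B 1 "k + 2"] mono by simp
  then show ?case
    using same out Suc.IH assms(1) unfolding add_Suc_right
    by (intro state_after_Suc_cong) auto
qed

text \<open>
  For \<open>T \<le> 0\<close> the outputs to be checked precede the change, so the change is scheduled late enough.
\<close>

lemma not_round_algorithm:
  fixes T :: int
  assumes "pair_graph G\<^sub>0" "change G\<^sub>0 G\<^sub>1" "G\<^sub>0 \<noteq> G\<^sub>1" "change G\<^sub>0 G\<^sub>2" "G\<^sub>0 \<noteq> G\<^sub>2"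
    and v: "v \<in> pverts G\<^sub>0" "v \<in> pverts G\<^sub>1" "v \<in> pverts G\<^sub>2"
    and B: "\<And>n. B n \<subseteq> B (Suc n)"
      "\<And>u. u \<notin> B 1 \<Longrightarrow> (u \<in> pverts G\<^sub>1 \<longleftrightarrow> u \<in> pverts G\<^sub>2) \<and> nbrs G\<^sub>1 u = nbrs G\<^sub>2 u"
      "\<And>n u y. y \<in> nbrs G\<^sub>1 u \<Longrightarrow> y \<in> B n \<Longrightarrow> u \<in> B (Suc n)"
    and far: "\<And>n. int n \<le> T + 1 \<Longrightarrow> v \<notin> B n"
    and "problem G\<^sub>1 v \<noteq> problem G\<^sub>2 v"
  shows "\<not> round_algorithm T change problem A"
proof
  assume A: "round_algorithm T change problem A"
  \<comment> \<open>The least \<open>i \<ge> 1\<close> for which \<open>i + T - 1\<close> is not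
    negative.\<close>
  define i where "i = nat (max 1 (1 - T))"
  define r where "r = nat (max T 0)"
  have ir: "1 \<le> i" "int r = int i + T - 1"
    by (auto simp: i_def r_def)
  have "state_after A (single_change i G\<^sub>0 G\<^sub>1) r v = state_after A (single_change i G\<^sub>0 G\<^sub>2) r v"
  proof (cases "T \<ge> 1")
    case True
    \<comment> \<open>By the end of round \<open>r = i + k\<close> information has reached at most
      \<open>B (k + 2)\<close>, and \<open>k + 2 = T + 1\<close> is the largest radius excluded by
      \<open>far\<close>.\<close>
    define k where "k = nat (T - 1)"
    have "r = i + k" "int (k + 2) \<le> T + 1"
      using ir True by (auto simp: k_def)
    with far[of "k + 2"] state_after_outside_ball[where B = B, OF ir(1) B] show ?thesis
      by simp
  next
    case False
    with ir have "r < i" by linarith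
    then show ?thesis
      by (intro state_after_cong) (simp add: single_change_def)
  qed
  moreover have "result A (state_after A (single_change i G\<^sub>0 G\<^sub>1) r v) = problem G\<^sub>1 v"
    "result A (state_after A (single_change i G\<^sub>0 G\<^sub>2) r v) = problem G\<^sub>2 v"
    using round_algorithm_single_change[OF A] assms ir by blast+
  ultimately show False
    using \<open>problem G\<^sub>1 v \<noteq> problem G\<^sub>2 v\<close> by simp
qed

text \<open>The assumption on \<open>problem\<close> is what listing and detection share. Both kinds
  of change lead to the same two final graphs \<open>K\<close> and \<open>K'\<close>; only the
  initial graph differs.\<close>

lemma not_round_algorithm_copies:
  fixes H :: "'a pair_pre_digraph" and T :: int
  assumes H: "pair_graph H" "Digraph_Component.connected (with_proj H)" "card (pverts H) \<ge> 2"
    and T: "ereal (real_of_int T) < diam H - 1"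
    and problem: "\<And>G G' v. copies_at H G v \<noteq> {} \<Longrightarrow> copies_at H G' v = {} \<Longrightarrow>
      problem G v \<noteq> problem G' v"
  shows "\<not> round_algorithm T node_insertion problem A"
    and "\<not> round_algorithm T node_deletion problem A"
proof -
  have fin: "finite (pverts H)"
    using H(1) by (simp add: pair_graph_iff)
  then obtain f :: "'a \<Rightarrow> nat" where f: "inj_on f (pverts H)"
    using finite_imp_inj_to_nat_seg[OF fin] by auto
  define K where "K = map_graph f H"
  have K: "pair_graph K"
    unfolding K_def using H(1) f by (rule pair_graph_map_graph)
  have card_K: "card (pverts K) = card (pverts H)" "finite (pverts K)"
    using f fin by (simp_all add: K_def card_image)
  obtain w where w: "w \<notin> pverts K"
    using card_K(2) ex_new_if_finite infinite_UNIV_nat by blast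
  from obtain_distant_nodes[OF H(1,3) T] obtain x' v' B'
    where xv': "x' \<in> pverts H" "v' \<in> pverts H" "x' \<noteq> v'" "x' \<in> B' 0"
      and B': "\<And>n :: nat. B' n \<subseteq> pverts H" "\<And>n. B' n \<subseteq> B' (Suc n)"
      "\<And>n y z. y \<in> B' n \<Longrightarrow> (y, z) \<in> parcs H \<Longrightarrow> z \<in> B' (Suc n)"
      and far': "\<And>n. int n \<le> T + 1 \<Longrightarrow> v' \<notin> B' n"
    by blast
  define x v where "x = f x'" and "v = f v'"
  \<comment> \<open>\<open>w\<close> joins every ball since its presence distinguishes
    \<open>K\<close> from \<open>K'\<close>; it spreads nothing, being adjacent to no node.\<close>
  define B where "B n = insert w (f ` B' n)" for n
  define K' where "K' = insert_node w {} (delete_node x K)"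
  have xv: "x \<in> pverts K" "v \<in> pverts K" "x \<noteq> v"
    using xv' f by (auto simp: x_def v_def K_def dest: inj_onD)
  have B_mono: "B n \<subseteq> B (Suc n)" for n
    using B'(2) by (auto simp: B_def)
  have B_step: "u \<in> B (Suc n)" if uy: "y \<in> nbrs K u" "y \<in> B n" for n u y
  proof -
    have "(y, u) \<in> parcs K"
      using uy(1) K by (auto simp: nbrs_def pair_graph_iff sym_def)
    then obtain a b where ab: "(a, b) \<in> parcs H" "y = f a" "u = f b"
      by (auto simp: K_def)
    have a: "a \<in> pverts H"
      using ab(1) H(1) by (auto simp: pair_graph_iff)
    then have "y \<noteq> w"
      using w ab(2) by (auto simp: K_def)
    then have "a \<in> B' n"
      using uy(2) ab(2) a f B'(1) by (auto simp: B_def dest: inj_onD)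
    then show ?thesis
      using B'(3) ab by (auto simp: B_def)
  qed
  \<comment> \<open>Removing \<open>x\<close> alters only the neighbour lists of \<open>x\<close>
    and of its neighbours, all in \<open>B 1\<close>.\<close>
  have B_same: "(u \<in> pverts K \<longleftrightarrow> u \<in> pverts K') \<and> nbrs K u = nbrs K' u" if u: "u \<notin> B 1" for u
  proof -
    have x: "x \<in> B 0" and "w \<in> B 1"
      using xv'(4) by (auto simp: B_def x_def)
    moreover from x have "x \<in> B 1"
      using B_mono[of 0] by auto
    moreover from x have "x \<notin> nbrs K u"
      using B_step[of x u 0] u by auto
    ultimately show ?thesis
      using u by (auto simp: K'_def nbrs_def)
  qed
  have far: "v \<notin> B n" if n: "int n \<le> T + 1" for n
    using far'[OF n] f B'(1)[of n] xv(2) xv'(2) w by (auto simp: B_def v_def dest: inj_onD)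
  have "K \<in> copies_at H K v"
    using map_graph_in_copies_at[OF H(1) f, of v] xv'(2) by (simp add: K_def v_def)
  moreover have "copies_at H K' v = {}"
  proof (rule copies_at_isolated_empty[OF H])
    \<comment> \<open>The node \<open>x\<close> is lost and \<open>w\<close> is gained.\<close>
    show "card (pverts K') \<le> card (pverts H)"
      using card_Suc_Diff1[OF card_K(2) xv(1)] card_K w by (simp add: K'_def)
    show "nbrs K' w = {}"
      using w K by (auto simp: K'_def nbrs_def pair_graph_iff)
  qed (use card_K in \<open>auto simp: K'_def\<close>)
  ultimately have differ: "problem K v \<noteq> problem K' v"
    using problem by blast
  have v': "v \<in> pverts K'"
    using xv by (simp add: K'_def)
  have xw: "x \<noteq> w" using xv(1) w by auto

  \<comment> \<open>Reinserting \<open>x\<close> with its old neighbours gives \<open>K\<close>;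
    inserting the isolated \<open>w\<close> gives \<open>K'\<close>.\<close>
  let ?K0 = "delete_node x K"
  have "node_insertion ?K0 (insert_node x (nbrs K x) ?K0)"
    using K by (intro node_insertion_insert_node) (auto simp: nbrs_def pair_graph_iff)
  then have "node_insertion ?K0 K"
    using K xv(1) by (simp add: insert_delete_node)
  moreover have "node_insertion ?K0 K'"
    using w by (auto simp: K'_def intro: node_insertion_insert_node)
  \<comment> \<open>Distinct vertex sets ensure that the round counts as a change.\<close>
  moreover have "pverts ?K0 \<noteq> pverts K" "pverts ?K0 \<noteq> pverts K'"
    using xv(1) w by (auto simp: K'_def)
  then have "?K0 \<noteq> K" "?K0 \<noteq> K'"
    by (metis, metis)
  ultimately show "\<not> round_algorithm T node_insertion problem A"
    using not_round_algorithm[of ?K0 node_insertion K K' v B T problem A, OF _ _ _ _ _ _ xv(2) v'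
        B_mono B_same B_step far differ] K xv pair_graph_delete_node[of K x]
    by simp

  \<comment> \<open>Deleting \<open>w\<close> gives \<open>K\<close>; deleting \<open>x\<close>
    gives \<open>K'\<close>.\<close>
  let ?K1 = "insert_node w {} K"
  have "node_deletion ?K1 (delete_node w ?K1)" "node_deletion ?K1 (delete_node x ?K1)"
    using xv(1) by (auto intro: node_deletion_delete_node)
  then have "node_deletion ?K1 K" "node_deletion ?K1 K'"
    using K w xw by (simp_all add: delete_insert_node delete_insert_isolated K'_def)
  moreover have "pverts ?K1 \<noteq> pverts K" "pverts ?K1 \<noteq> pverts K'"
    using xv(1) xw w by (auto simp: K'_def)
  then have "?K1 \<noteq> K" "?K1 \<noteq> K'"
    by (metis, metis)
  ultimately show "\<not> round_algorithm T node_deletion problem A"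
    using not_round_algorithm[of ?K1 node_deletion K K' v B T problem A, OF _ _ _ _ _ _ xv(2) v'
        B_mono B_same B_step far differ] K w xv pair_graph_insert_node[of K w "{}"]
    by simp
qed

theorem theorem2p13:
  fixes H :: "'a pair_pre_digraph" and T :: int
  assumes "pair_graph H"
    and "Digraph_Component.connected (with_proj H)"
    and "card (pverts H) \<ge> 3"
    and "ereal (real_of_int T) < diam H - 1"
  shows "\<not> (\<exists>A :: ('s, 'm, network set) algorithm. round_algorithm T node_insertion (mem_list H) A)
       \<and> \<not> (\<exists>A :: ('s, 'm, bool) algorithm. round_algorithm T node_insertion (mem_detect H) A)
       \<and> \<not> (\<exists>A :: ('s, 'm, network set) algorithm. round_algorithm T node_deletion (mem_list H) A)
       \<and> \<not> (\<exists>A :: ('s, 'm, bool) algorithm. round_algorithm T node_deletion (mem_detect H) A)"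
proof -
  have "card (pverts H) \<ge> 2"
    using assms(3) by simp
  note impossible = not_round_algorithm_copies[OF assms(1,2) this assms(4)]
  show ?thesis
    \<comment> \<open>An empty and a nonempty set of copies differ both as lists and in the truth
      value of nonemptiness.\<close>
    using impossible[of "mem_list H"] impossible[of "mem_detect H"]
    unfolding mem_list_def mem_detect_def by metis
qed

end
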